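(* For all natural numbers $k \geq 2$ and $n \geq 3$, the cylindrical grid graph $P_k \Box C_n$ contains Type-2 neighbourhood chains (NC-T2).
   Context: All graphs are finite, undirected and simple. $P_k$ is the path on $k$ vertices, $C_n$ is the cycle on $n$ vertices, and $G\Box H$ is the Cartesian product: vertex set $V(G)\times V(H)$, with $(u,v)$ adjacent to $(u',v')$ iff either $u=u'$ and $vv'\in E(H)$, or $v=v'$ and $uu'\in E(G)$. For a graph $G$ and $u\in V(G)$, $N(u)=\{v\in V(G): uv\in E(G)\}$ and $N[u]=N(u)\cup\{u\}$. Neighbourhood chain. Let $\ell\ge 2$, let $u_1,\dots,u_\ell\in V(G)$ with $|N[u_i]|>1$ for all $i$, and put $N_i=N(u_i)$. The sequence $N_1N_2\cdots N_\ell$ is a neighbourhood chain of length $\ell$ in $G$ if $N_i\cap N_{i+1}\neq\emptyset$ for $1\le i\le \ell-1$, and non-consecutive terms other than the pair (first, last) are disjoint, i.e. $N_i\cap N_j=\emptyset$ whenever $1<|i-j|<\ell-1$ (no such restriction is placed on the pair $N_1,N_\ell$). Type 1 (NC-T1). Let $\ell\ge 2$ and $m\ge \ell+1$. Let $\{u_1,\dots,u_\ell\}$ and $\{v_1,\dots,v_m\}$ be disjoint subsets of $V(G)$ with $u_1\ne u_\ell$ and $v_1,\dots,v_m$ pairwise distinct, such that for each $i$, $N_i=N(u_i)=\{v_j : 1\le j\le m,\ u_iv_j\in E(G)\}\neq\emptyset$ (so all neighbours of every $u_i$ lie among the $v_j$). A neighbourhood chain $N_1N_2\cdots N_\ell$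 in $G$ is of Type 1 (an NC-T1 of length $\ell$) if (i) $N_1\setminus N_2=\{v_1\}$ and $N_\ell\setminus N_{\ell-1}=\{v_\ell\}$; (ii) $N_{i+1}\setminus N_i\subseteq N_{i+2}$ for $i=1,\dots,\ell-2$, and $|N_i\setminus N_{i+1}|\ge 1$ and $|N_{i+1}\setminus N_i|\ge 1$ for $i=1,\dots,\ell-1$. Type 2 (NC-T2). Let $\ell\ge2$ and let $N_1N_2\cdots N_\ell$ and $N_{\ell+1}N_{\ell+2}\cdots N_{2\ell}$ be two NC-T1 in $G$ (each being of Type 1 with respect to its own vertices $u$ and its own labelling of the $v$'s). These two chains form Type-2 neighbourhood chains (NC-T2) if (i) $N_1\cap N_2\cap N_{\ell+1}=N_{\ell+1}\setminus N_{\ell+2}\neq\emptyset$ and $N_\ell\cap N_{2\ell}\cap N_{2\ell-1}=N_\ell\setminus N_{\ell-1}\neq\emptyset$; (ii) $N_i\cap N_{i+1}\cap N_{\ell+i}\cap N_{\ell+i-1}\neq\emptyset$ for $i=2,3,\dots,\ell-1$. *)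

theory Defs
  imports "Graph_Theory.Pair_Digraph"
begin

text \<open>
  A finite simple undirected graph is a \<^locale>\<open>pair_graph\<close>: a finite, loop-free digraph
  without parallel arcs whose arc relation is symmetric.  An edge \<open>uv\<close> is represented by the
  two arcs \<open>(u, v)\<close> and \<open>(v, u)\<close>.
\<close>

definition path_graph :: "nat \<Rightarrow> nat pair_pre_digraph" where
  "path_graph k =
     \<lparr> pverts = {0..<k},
       parcs = {(i, j). i < k \<and> j < k \<and> (j = Suc i \<or> i = Suc j)} \<rparr>"

text \<open>Meaningful for \<open>n \<ge> 3\<close> only; for \<open>n = 1\<close> the formula would produce a loop.\<close>

definition cycle_graph :: "nat \<Rightarrow> nat pair_pre_digraph" where
  "cycle_graph n =
     \<lparr> pverts = {0..<n},
       parcs = {(i, j). i < n \<and> j < n \<and> (j = Suc i mod n \<or> i = Suc j mod n)} \<rparr>"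

definition cartesian_product ::
  "'a pair_pre_digraph \<Rightarrow> 'b pair_pre_digraph \<Rightarrow> ('a \<times> 'b) pair_pre_digraph"
  (infixr "\<box>" 80) where
  "G \<box> H =
     \<lparr> pverts = pverts G \<times> pverts H,
       parcs = {((u, v), (u', v')).
                  (u = u' \<and> u \<in> pverts G \<and> (v, v') \<in> parcs H) \<or>
                  (v = v' \<and> v \<in> pverts H \<and> (u, u') \<in> parcs G)} \<rparr>"

definition nbhd :: "'a pair_pre_digraph \<Rightarrow> 'a \<Rightarrow> 'a set" where
  "nbhd G u = {v \<in> pverts G. (u, v) \<in> parcs G}"

definition closed_nbhd :: "'a pair_pre_digraph \<Rightarrow> 'a \<Rightarrow> 'a set" where
  "closed_nbhd G u = nbhd G u \<union> {u}"

text \<open>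
  A chain \<open>N\<^sub>1 \<dots> N\<^sub>l\<close> is given by the vertices \<open>u 1, \<dots>, u l\<close> with \<open>N\<^sub>i = nbhd G (u i)\<close>; the
  values of \<open>u\<close> outside \<open>{1..l}\<close> are irrelevant.  The disjointness condition is symmetric in
  \<open>i\<close> and \<open>j\<close>, so it is only stated for \<open>i < j\<close>.
\<close>

definition nbhd_chain :: "'a pair_pre_digraph \<Rightarrow> nat \<Rightarrow> (nat \<Rightarrow> 'a) \<Rightarrow> bool" where
  "nbhd_chain G l u \<longleftrightarrow>
     (let N = (\<lambda>i. nbhd G (u i)) in
       l \<ge> 2 \<and>
       (\<forall>i\<in>{1..l}. u i \<in> pverts G \<and> card (closed_nbhd G (u i)) > 1) \<and>
       (\<forall>i\<in>{1..l-1}. N i \<inter> N (i+1) \<noteq> {}) \<and>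
       (\<forall>i\<in>{1..l}. \<forall>j\<in>{1..l}. i < j \<and> 1 < j - i \<and> j - i < l - 1 \<longrightarrow> N i \<inter> N j = {}))"

text \<open>
  \<open>NC_T1_wrt\<close> is Type 1 with respect to a given labelling \<open>v 1, \<dots>, v m\<close>.  As with \<open>u\<close>, only
  the values of \<open>v\<close> on \<open>{1..m}\<close> matter.  Of the \<open>u i\<close>, only \<open>u 1\<close> and \<open>u l\<close> are explicitly
  required to be distinct.
\<close>

definition NC_T1_wrt ::
  "'a pair_pre_digraph \<Rightarrow> nat \<Rightarrow> (nat \<Rightarrow> 'a) \<Rightarrow> nat \<Rightarrow> (nat \<Rightarrow> 'a) \<Rightarrow> bool" where
  "NC_T1_wrt G l u m v \<longleftrightarrow>
     (let N = (\<lambda>i. nbhd G (u i)) in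
       l \<ge> 2 \<and> m \<ge> l + 1 \<and>
       u ` {1..l} \<subseteq> pverts G \<and> v ` {1..m} \<subseteq> pverts G \<and>
       u ` {1..l} \<inter> v ` {1..m} = {} \<and>
       u 1 \<noteq> u l \<and> inj_on v {1..m} \<and>
       (\<forall>i\<in>{1..l}. N i = {v j | j. j \<in> {1..m} \<and> (u i, v j) \<in> parcs G} \<and> N i \<noteq> {}) \<and>
       nbhd_chain G l u \<and>
       N 1 - N 2 = {v 1} \<and> N l - N (l-1) = {v l} \<and>
       (\<forall>i\<in>{1..l-2}. N (i+1) - N i \<subseteq> N (i+2)) \<and>
       (\<forall>i\<in>{1..l-1}. card (N i - N (i+1)) \<ge> 1 \<and> card (N (i+1) - N i) \<ge> 1))"

definition NC_T1 :: "'a pair_pre_digraph \<Rightarrow> nat \<Rightarrow> (nat \<Rightarrow> 'a) \<Rightarrow> bool" where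
  "NC_T1 G l u \<longleftrightarrow> (\<exists>m v. NC_T1_wrt G l u m v)"

text \<open>
  The second chain \<open>N\<^sub>l\<^sub>+\<^sub>1 \<dots> N\<^sub>2\<^sub>l\<close> is indexed by \<open>1, \<dots>, l\<close> through its own vertices \<open>w\<close>, i.e.
  \<open>M i\<close> below stands for \<open>N\<^sub>l\<^sub>+\<^sub>i\<close>.
\<close>

definition NC_T2 :: "'a pair_pre_digraph \<Rightarrow> nat \<Rightarrow> (nat \<Rightarrow> 'a) \<Rightarrow> (nat \<Rightarrow> 'a) \<Rightarrow> bool" where
  "NC_T2 G l u w \<longleftrightarrow>
     (let N = (\<lambda>i. nbhd G (u i)); M = (\<lambda>i. nbhd G (w i)) in
       l \<ge> 2 \<and> NC_T1 G l u \<and> NC_T1 G l w \<and>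
       N 1 \<inter> N 2 \<inter> M 1 = M 1 - M 2 \<and> M 1 - M 2 \<noteq> {} \<and>
       N l \<inter> M l \<inter> M (l-1) = N l - N (l-1) \<and> N l - N (l-1) \<noteq> {} \<and>
       (\<forall>i\<in>{2..l-1}. N i \<inter> N (i+1) \<inter> M i \<inter> M (i-1) \<noteq> {}))"

definition contains_NC_T2 :: "'a pair_pre_digraph \<Rightarrow> bool" where
  "contains_NC_T2 G \<longleftrightarrow> (\<exists>l u w. NC_T2 G l u w)"

lemma pair_graphI:
  assumes "finite (pverts G)" and "parcs G \<subseteq> pverts G \<times> pverts G"
    and "sym (parcs G)" and "irrefl (parcs G)"
  shows "pair_graph G"
proof unfold_locales
  show "finite (parcs G)"
    using assms(1,2) by (meson finite_SigmaI finite_subset)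
  show "fst e \<noteq> snd e" if "e \<in> parcs G" for e
    using assms(4) that by (cases e) (auto simp: irrefl_def)
  show "symmetric (with_proj G)"
    using assms(3) by (simp add: symmetric_def)
qed (use assms(1,2) in auto)

lemma pair_graph_path_graph: "pair_graph (path_graph k)"
  by (rule pair_graphI) (auto simp: path_graph_def sym_def irrefl_def)

lemma pair_graph_cycle_graph:
  assumes "n \<ge> 3"
  shows "pair_graph (cycle_graph n)"
proof (rule pair_graphI)
  have "Suc i mod n \<noteq> i" if "i < n" for i
    using assms that by (cases "Suc i = n") auto
  then show "irrefl (parcs (cycle_graph n))"
    unfolding cycle_graph_def irrefl_def by fastforce
  show "sym (parcs (cycle_graph n))"
    unfolding cycle_graph_def sym_def by simp blast
qed (auto simp: cycle_graph_def)

lemma pair_graph_cartesian_product: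
  assumes "pair_graph G" and "pair_graph H"
  shows "pair_graph (G \<box> H)"
proof -
  interpret G: pair_graph G by fact
  interpret H: pair_graph H by fact
  have sG: "sym (parcs G)" and sH: "sym (parcs H)"
    using G.pair_sym_arcs H.pair_sym_arcs by (simp_all add: symmetric_def)
  show ?thesis
  proof (rule pair_graphI)
    show "finite (pverts (G \<box> H))"
      using G.pair_finite_verts H.pair_finite_verts by (simp add: cartesian_product_def)
    show "parcs (G \<box> H) \<subseteq> pverts (G \<box> H) \<times> pverts (G \<box> H)"
      by (auto simp: cartesian_product_def
          dest: G.in_arcsD1 G.in_arcsD2 H.in_arcsD1 H.in_arcsD2)
    show "sym (parcs (G \<box> H))"
      using sG sH unfolding sym_def by (auto simp: cartesian_product_def)
    show "irrefl (parcs (G \<box> H))"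
      using G.pair_no_loops H.pair_no_loops
      unfolding irrefl_def cartesian_product_def by fastforce
  qed
qed

end

theory Submission
  imports Defs
begin

text \<open>
  Let \<open>u\<^sub>i\<close> be the vertex in row \<open>i - 1\<close> and column \<open>i - 1 + s\<close> (modulo \<open>n\<close>), so that
  \<open>u\<^sub>1, \<dots>, u\<^sub>k\<close> is a diagonal from the bottom of the cylinder to the top.  Consecutive
  \<open>u\<^sub>i\<close> share exactly two neighbours, the other two corners of a unit square, while
  for \<open>\<bar>i - j\<bar> \<ge> 2\<close> the neighbourhoods are disjoint: their rows only meet if \<open>\<bar>i - j\<bar> = 2\<close>,
  and then the columns differ by \<open>2\<close>, which is not a multiple of \<open>n\<close>.  The diagonals starting
  in columns \<open>0\<close> and \<open>2\<close> are of Type 1 and share the vertices in row \<open>i - 1\<close> and column \<open>i\<close>,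
  which gives Type 2.
\<close>

text \<open>Needed because Type 1 prescribes the labels at positions 1 and \<open>l\<close> only.
  Removing two points from each side leaves sets of equal size, which can be matched
  arbitrarily.\<close>

lemma ex_bij_betw_two_values:
  assumes "finite S" "a \<in> S" "b \<in> S" "a \<noteq> b" "p \<noteq> q" "p \<in> T" "q \<in> T" "finite T" "card T = card S"
  obtains v where "bij_betw v T S" "v p = a" "v q = b"
proof -
  have "card (T - {p, q}) = card (S - {a, b})"
    using assms by (simp add: card_Diff_subset)
  then obtain f where f: "bij_betw f (T - {p, q}) (S - {a, b})"
    using assms(1,8) finite_same_card_bij by blast
  define v where "v = f(p := a, q := b)"
  have 1: "bij_betw v (T - {p, q}) (S - {a, b})"
    using f by (rule bij_betw_cong[THEN iffD1, rotated]) (auto simp: v_def)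
  have 2: "bij_betw v {p, q} {a, b}"
    using assms by (auto simp: v_def bij_betw_def)
  have "bij_betw v ((T - {p, q}) \<union> {p, q}) ((S - {a, b}) \<union> {a, b})"
    by (rule bij_betw_combine[OF 1 2]) auto
  moreover have "(T - {p, q}) \<union> {p, q} = T" "(S - {a, b}) \<union> {a, b} = S"
    using assms by auto
  ultimately have "bij_betw v T S" by simp
  with that show thesis
    using assms by (simp add: v_def)
qed

text \<open>Eliminates the labelling \<open>v\<close>: it may be any enumeration of the union of the
  neighbourhoods, with \<open>m\<close> its cardinality, that has \<open>a\<close> at position 1 and
  \<open>b\<close> at position \<open>l\<close>. What remains concerns the sets \<open>N i\<close>
  alone.\<close>

lemma NC_T1I:
  fixes G l u
  defines "N \<equiv> \<lambda>i. nbhd G (u i)"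
  assumes fin: "finite (pverts G)"
    and chain: "nbhd_chain G l u"
    and indep: "\<And>i j. i \<in> {1..l} \<Longrightarrow> j \<in> {1..l} \<Longrightarrow> u i \<notin> N j"
    and ends: "u 1 \<noteq> u l" "N 1 - N 2 = {a}" "N l - N (l - 1) = {b}" "a \<noteq> b"
    and step: "\<And>i. i \<in> {1..l - 2} \<Longrightarrow> N (i + 1) - N i \<subseteq> N (i + 2)"
    and diff: "\<And>i. i \<in> {1..l - 1} \<Longrightarrow> N i - N (i + 1) \<noteq> {} \<and> N (i + 1) - N i \<noteq> {}"
    and many: "l + 1 \<le> card (\<Union>i\<in>{1..l}. N i)"
  shows "NC_T1 G l u"
proof -
  have l: "l \<ge> 2" and verts: "\<And>i. i \<in> {1..l} \<Longrightarrow> u i \<in> pverts G"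
    and big: "\<And>i. i \<in> {1..l} \<Longrightarrow> card (closed_nbhd G (u i)) > 1"
    using chain by (auto simp: nbhd_chain_def Let_def)
  define S where "S = (\<Union>i\<in>{1..l}. N i)"
  have big_S: "l + 1 \<le> card S" using many by (simp add: S_def)
  have sub: "S \<subseteq> pverts G"
    by (auto simp: S_def N_def nbhd_def)
  then have finS: "finite S" using fin finite_subset by blast
  have finN: "finite (N i)" for i
    using fin by (auto simp: N_def nbhd_def)
  have ne: "N i \<noteq> {}" if "i \<in> {1..l}" for i
    using big[OF that] by (auto simp: closed_nbhd_def N_def)
  have "N 1 \<subseteq> S" "N l \<subseteq> S"
    unfolding S_def by (rule UN_upper; use l in simp)+
  with ends have ab: "a \<in> S" "b \<in> S" by blast+
  obtain v where v: "bij_betw v {1..card S} S" "v 1 = a" "v l = b"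
    by (rule ex_bij_betw_two_values[of S a b 1 l "{1..card S}"])
      (use finS ab ends(4) l big_S in simp_all)
  then have img: "v ` {1..card S} = S" and inj: "inj_on v {1..card S}"
    by (auto simp: bij_betw_def)
  have nb: "N i = {v j | j. j \<in> {1..card S} \<and> (u i, v j) \<in> parcs G}" if "i \<in> {1..l}" for i
  proof -
    have "N i \<subseteq> S"
      unfolding S_def using that by (rule UN_upper)
    then have "N i = {x \<in> v ` {1..card S}. (u i, x) \<in> parcs G}"
      unfolding img using sub by (auto simp: N_def nbhd_def)
    also have "\<dots> = {v j | j. j \<in> {1..card S} \<and> (u i, v j) \<in> parcs G}"
      by blast
    finally show ?thesis .
  qed
  have "NC_T1_wrt G l u (card S) v"
    unfolding NC_T1_wrt_def Let_def N_def[symmetric]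
  proof (intro conjI ballI)
    show "u ` {1..l} \<inter> v ` {1..card S} = {}"
      unfolding img using indep by (auto simp: S_def)
    show "v ` {1..card S} \<subseteq> pverts G"
      unfolding img by (rule sub)
    show "card (N i - N (i + 1)) \<ge> 1" "card (N (i + 1) - N i) \<ge> 1" if "i \<in> {1..l - 1}" for i
      using diff[OF that] finN by (simp_all add: Suc_le_eq card_gt_0_iff)
    show "N 1 - N 2 = {v 1}" "N l - N (l - 1) = {v l}"
      unfolding v(2,3) by (rule ends)+
  qed (fact l big_S inj ends(1) chain | erule nb ne step | use verts in blast)+
  then show ?thesis unfolding NC_T1_def by blast
qed

locale cylinder =
  fixes k n :: nat
  assumes k: "k \<ge> 2" and n: "n \<ge> 3"
begin

abbreviation "G \<equiv> path_graph k \<box> cycle_graph n"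

text \<open>Integer columns avoid case distinctions at the seam of the cylinder: equality of columns
  becomes divisibility of their difference by \<open>n\<close>.\<close>

definition pt :: "nat \<Rightarrow> int \<Rightarrow> nat \<times> nat" where
  "pt r c = (r, nat (c mod int n))"

lemma pt_eq_iff: "pt r c = pt r' c' \<longleftrightarrow> r = r' \<and> int n dvd c - c'"
  using n by (auto simp: pt_def eq_nat_nat_iff mod_eq_dvd_iff)

text \<open>The column differences that separate vertices of the same row below are 1 or 2 up to
  sign, so \<open>n \<ge> 3\<close> keeps them distinct.\<close>

lemma not_dvd_small [simp]:
  "\<not> int n dvd 1" "\<not> int n dvd 2" "\<not> int n dvd - 1" "\<not> int n dvd - 2" "n \<noteq> Suc 0"
  using n by (auto dest: zdvd_imp_le)

lemma nat_mod_eq_Suc_mod_iff: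
  assumes "j < n"
  shows "nat (c mod int n) = Suc j mod n \<longleftrightarrow> int n dvd int j - (c - 1)"
proof -
  have "nat (c mod int n) = Suc j mod n \<longleftrightarrow> c mod int n = int (Suc j mod n)"
    using assms by (subst nat_eq_iff) simp
  also have "\<dots> \<longleftrightarrow> (int j + 1) mod int n = c mod int n"
    by (auto simp: zmod_int add.commute)
  also have "\<dots> \<longleftrightarrow> int n dvd int j - (c - 1)"
    by (simp add: mod_eq_dvd_iff algebra_simps)
  finally show ?thesis .
qed

lemma pt_in_verts: "r < k \<Longrightarrow> pt r c \<in> pverts G"
  using n by (simp add: pt_def cartesian_product_def path_graph_def cycle_graph_def nat_less_iff)

lemma nbhd_pt:
  assumes "r < k"
  shows "nbhd G (pt r c) = {pt r (c + 1), pt r (c - 1)}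
    \<union> {x. x = pt (Suc r) c \<and> Suc r < k} \<union> {x. x = pt (r - 1) c \<and> 0 < r}"
  (is "_ = ?R")
proof (rule set_eqI)
  fix x :: "nat \<times> nat"
  obtain a b where x: "x = (a, b)" by force
  show "x \<in> nbhd G (pt r c) \<longleftrightarrow> x \<in> ?R"
  proof (cases "b < n")
    case True
    then have x': "x = pt a (int b)" by (simp add: x pt_def)
    have n0: "n > 0" using n by simp
    \<comment> \<open>\<open>e\<close>, \<open>s\<close> and \<open>p\<close> turn "same column",
      "next column" and "previous column" into divisibility.\<close>
    have e: "int n dvd int b - c \<longleftrightarrow> nat (c mod int n) = b"
      using pt_eq_iff[of 0 "int b" 0 c] True by (auto simp: pt_def)
    have s: "b = Suc (nat (c mod int n)) mod n \<longleftrightarrow> int n dvd int b - (c + 1)"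
    proof -
      have "int n dvd int b - (c + 1) \<longleftrightarrow> int b mod int n = (c + 1) mod int n"
        by (simp add: mod_eq_dvd_iff)
      also have "\<dots> \<longleftrightarrow> int b = int (Suc (nat (c mod int n)) mod n)"
        using True n0 by (simp add: zmod_int mod_simps add.commute)
      finally show ?thesis by simp
    qed
    note p = nat_mod_eq_Suc_mod_iff[OF True, of c]
    have "x \<in> nbhd G (pt r c) \<longleftrightarrow> a < k \<and> (a = r \<and> (int n dvd int b - (c + 1) \<or> int n dvd int b - (c - 1))
        \<or> int n dvd int b - c \<and> (a = Suc r \<or> r = Suc a))"
      using True assms n0 unfolding s[symmetric] p[symmetric] e
      by (auto simp: nbhd_def x pt_def cartesian_product_def path_graph_def cycle_graph_def nat_less_iff)
    also have "\<dots> \<longleftrightarrow> x \<in> ?R"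
      unfolding x' using assms by (auto simp: pt_eq_iff)
    finally show ?thesis .
  next
    case False
    then show ?thesis
      using n by (auto simp: x nbhd_def cartesian_product_def cycle_graph_def pt_def nat_less_iff)
  qed
qed

definition diag :: "int \<Rightarrow> nat \<Rightarrow> nat \<times> nat" where
  "diag s i = pt (i - 1) (int (i - 1) + s)"

text \<open>The neighbours split into two pairs: right and upper are shared with
  \<open>diag s (i + 1)\<close>, left and lower with \<open>diag s (i - 1)\<close>. Hence whatever
  \<open>diag s (i + 1)\<close> does not share with its predecessor it shares with its successor.
  The guards drop the vertical neighbour at the boundary rows.\<close>

lemma nbhd_diag:
  assumes "i \<in> {1..k}"
  shows "nbhd G (diag s i) = {pt (i - 1) (int i + s), pt (i - 1) (int i + s - 2)}
    \<union> {x. x = pt i (int i + s - 1) \<and> i < k} \<union> {x. x = pt (i - 2) (int i + s - 1) \<and> 1 < i}"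
  using assms unfolding diag_def
  by (subst nbhd_pt) (auto simp: of_nat_diff algebra_simps numeral_2_eq_2)

lemma nbhd_chain_diag: "nbhd_chain G k (diag s)"
  unfolding nbhd_chain_def Let_def
proof (intro conjI ballI impI)
  show "k \<ge> 2" by (rule k)
next
  fix i assume i: "i \<in> {1..k}"
  then show "diag s i \<in> pverts G" by (auto simp: diag_def pt_in_verts)
  have "diag s i \<noteq> pt (i - 1) (int i + s)"
    using i by (simp add: diag_def pt_eq_iff)
  then have "2 = card {diag s i, pt (i - 1) (int i + s)}" by simp
  also have "\<dots> \<le> card (closed_nbhd G (diag s i))"
    using i by (intro card_mono) (auto simp: closed_nbhd_def nbhd_diag)
  finally show "card (closed_nbhd G (diag s i)) > 1" by simp
next
  fix i assume "i \<in> {1..k - 1}"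
  then show "nbhd G (diag s i) \<inter> nbhd G (diag s (i + 1)) \<noteq> {}"
    using k by (auto simp: nbhd_diag pt_eq_iff)
next
  fix i j assume ij: "i \<in> {1..k}" "j \<in> {1..k}" and "i < j \<and> 1 < j - i \<and> j - i < k - 1"
  then consider "j = i + 2" | "i + 2 < j" by linarith
  then show "nbhd G (diag s i) \<inter> nbhd G (diag s j) = {}"
    unfolding nbhd_diag[OF ij(1)] nbhd_diag[OF ij(2)]
    by cases (use ij in \<open>auto simp: pt_eq_iff\<close>)
qed

lemma NC_T1_diag: "NC_T1 G k (diag s)"
proof (rule NC_T1I)
  show "finite (pverts G)"
    by (simp add: cartesian_product_def path_graph_def cycle_graph_def)
  show "nbhd_chain G k (diag s)" by (rule nbhd_chain_diag)
  show "diag s i \<notin> nbhd G (diag s j)" if ij: "i \<in> {1..k}" "j \<in> {1..k}" for i j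
  proof -
    \<comment> \<open>In the first three cases the only candidates in the row of
      \<open>diag s i\<close> are one column away; in the last two no row is common.\<close>
    consider "i = j" | "j = i + 1" | "i = j + 1" | "i + 1 < j" | "j + 1 < i" by linarith
    then show ?thesis
      unfolding nbhd_diag[OF ij(2)] unfolding diag_def
      by cases (use ij in \<open>auto simp: pt_eq_iff\<close>)
  qed
  show "diag s 1 \<noteq> diag s k"
    using k by (simp add: diag_def pt_eq_iff)
  \<comment> \<open>At either end one vertical neighbour is missing, so exactly one horizontal
    neighbour is unshared: the left one in row 0, the right one in row \<open>k - 1\<close>.\<close>
  show "nbhd G (diag s 1) - nbhd G (diag s 2) = {pt 0 (s - 1)}"
    using k by (auto simp: nbhd_diag pt_eq_iff)
  show "nbhd G (diag s k) - nbhd G (diag s (k - 1)) = {pt (k - 1) (int k + s)}"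
    using k by (auto simp: nbhd_diag pt_eq_iff)
  show "pt 0 (s - 1) \<noteq> pt (k - 1) (int k + s)"
    using k by (simp add: pt_eq_iff)
  show "nbhd G (diag s (i + 1)) - nbhd G (diag s i) \<subseteq> nbhd G (diag s (i + 2))" if "i \<in> {1..k - 2}" for i
    using that by (auto simp: nbhd_diag pt_eq_iff)
  show "nbhd G (diag s i) - nbhd G (diag s (i + 1)) \<noteq> {} \<and>
      nbhd G (diag s (i + 1)) - nbhd G (diag s i) \<noteq> {}" if "i \<in> {1..k - 1}" for i
  proof -
    \<comment> \<open>Horizontal witnesses are chosen since they exist in the boundary rows
      too.\<close>
    have "pt (i - 1) (int i + s - 2) \<in> nbhd G (diag s i) - nbhd G (diag s (i + 1))"
      using that by (auto simp: nbhd_diag pt_eq_iff)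
    moreover have "pt i (int i + s + 1) \<in> nbhd G (diag s (i + 1)) - nbhd G (diag s i)"
      using that by (auto simp: nbhd_diag pt_eq_iff)
    ultimately show ?thesis by blast
  qed
  show "k + 1 \<le> card (\<Union>i\<in>{1..k}. nbhd G (diag s i))"
  proof -
    \<comment> \<open>The right neighbours lie in \<open>k\<close> distinct rows; the left neighbour
      of \<open>diag s 1\<close> is one more vertex.\<close>
    let ?f = "\<lambda>i. pt (i - 1) (int i + s)"
    have "card (?f ` {1..k}) = k"
      by (subst card_image) (auto simp: inj_on_def pt_eq_iff)
    moreover have "pt 0 (s - 1) \<notin> ?f ` {1..k}"
      by (auto simp: pt_eq_iff)
    ultimately have "card (insert (pt 0 (s - 1)) (?f ` {1..k})) = k + 1" by simp
    moreover have "insert (pt 0 (s - 1)) (?f ` {1..k}) \<subseteq> (\<Union>i\<in>{1..k}. nbhd G (diag s i))"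
      using k by (force simp: nbhd_diag)
    moreover have "finite (\<Union>i\<in>{1..k}. nbhd G (diag s i))"
      by (simp add: nbhd_diag)
    ultimately show ?thesis by (metis card_mono)
  qed
qed

text \<open>With offset 2, \<open>pt (i - 1) (int i)\<close> is right of \<open>diag 0 i\<close>,
  left of \<open>diag 2 i\<close>, below \<open>diag 0 (i + 1)\<close> and above
  \<open>diag 2 (i - 1)\<close>. For \<open>i = 1\<close> and \<open>i = k\<close> it is the only
  element of the respective end difference.\<close>

lemma NC_T2_diag: "NC_T2 G k (diag 0) (diag 2)"
  unfolding NC_T2_def Let_def
proof (intro conjI ballI)
  show "nbhd G (diag 0 1) \<inter> nbhd G (diag 0 2) \<inter> nbhd G (diag 2 1)
      = nbhd G (diag 2 1) - nbhd G (diag 2 2)"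
    using k by (auto simp: nbhd_diag pt_eq_iff)
  show "nbhd G (diag 2 1) - nbhd G (diag 2 2) \<noteq> {}"
    using k by (auto simp: nbhd_diag pt_eq_iff)
  show "nbhd G (diag 0 k) \<inter> nbhd G (diag 2 k) \<inter> nbhd G (diag 2 (k - 1))
      = nbhd G (diag 0 k) - nbhd G (diag 0 (k - 1))"
    using k by (auto simp: nbhd_diag pt_eq_iff)
  show "nbhd G (diag 0 k) - nbhd G (diag 0 (k - 1)) \<noteq> {}"
    using k by (auto simp: nbhd_diag pt_eq_iff)
  fix i assume i: "i \<in> {2..k - 1}"
  then have "i - 1 \<in> {1..k}" by auto
  then have "pt (i - 1) (int i) \<in> nbhd G (diag 0 i) \<inter> nbhd G (diag 0 (i + 1)) \<inter>
      nbhd G (diag 2 i) \<inter> nbhd G (diag 2 (i - 1))"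
    using i by (auto simp: nbhd_diag pt_eq_iff)
  then show "nbhd G (diag 0 i) \<inter> nbhd G (diag 0 (i + 1)) \<inter>
      nbhd G (diag 2 i) \<inter> nbhd G (diag 2 (i - 1)) \<noteq> {}" by blast
qed (use k NC_T1_diag in auto)

end

theorem theorem3p4:
  fixes k n :: nat
  assumes "k \<ge> 2" and "n \<ge> 3"
  shows "contains_NC_T2 (path_graph k \<box> cycle_graph n)"
proof -
  interpret cylinder k n using assms by unfold_locales
  show ?thesis unfolding contains_NC_T2_def using NC_T2_diag by blast
qed

end
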